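(* Let $a>b>0$, $c>0$, and consider the ellipsoid $\frac{x^2}{a^2}+\frac{y^2}{b^2}+\frac{z^2}{c^2}=1$ in the Minkowski 3-space $\mathbb{R}^{2,1}$, parametrized by $$\alpha(u,v)=\Bigl(a\cos u\sqrt{\tfrac{a^2-b^2}{a^2+c^2}\cos^2v+\sin^2v},\ b\sin u\sin v,\ c\cos v\sqrt{\tfrac{b^2+c^2}{a^2+c^2}\cos^2u+\sin^2u}\Bigr).$$ Then, for a suitable labelling of the two sheets, the focal set $\mathcal{F}_1$ of the ellipsoid is parametrized by $(A_1(u,v),B_1(u,v),C_1(u,v))$, where $$A_1=\frac{(a^2-b^2)\cos^3u}{a\sqrt{a^2+c^2}}\sqrt{(a^2-b^2)\cos^2v+(a^2+c^2)\sin^2v},\qquad B_1=-\frac{(a^2-b^2)\sin^3u\,\sin v}{b},$$ $$C_1=\frac{\cos v}{c\sqrt{a^2+c^2}}\left[(b^2+c^2)\cos^2u+(a^2+c^2)\sin^2u\right]^{3/2},$$ and the focal set $\mathcal{F}_2$ of the ellipsoid is parametrized by $(A_2(u,v),B_2(u,v),C_2(u,v))$, where $$A_2=\frac{\cos u}{a\sqrt{a^2+c^2}}\left[(a^2-b^2)\cos^2v+(a^2+c^2)\sin^2v\right]^{3/2},\qquad B_2=\frac{(b^2+c^2)\sin u\,\sin^3v}{b},$$ $$C_2=\frac{(b^2+c^2)\cos^3v}{c\sqrt{a^2+c^2}}\sqrt{(b^2+c^2)\cos^2u+(a^2+c^2)\sin^2u}.$$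
   Context: The Minkowski 3-space $\mathbb{R}^{2,1}$ is $\mathbb{R}^3$ with $\langle p,q\rangle=p_1q_1+p_2q_2-p_3q_3$; the vector product is characterized by $\langle p\times q,r\rangle=\det(p,q,r)$ for all $r$; $\|p\|=\sqrt{|\langle p,p\rangle|}$. For a parametrization $\alpha(u,v)$ of a surface put $E=\langle\alpha_u,\alpha_u\rangle$, $F=\langle\alpha_u,\alpha_v\rangle$, $G=\langle\alpha_v,\alpha_v\rangle$, and, where $EG-F^2\neq0$, $N=\epsilon\frac{\alpha_u\times\alpha_v}{\|\alpha_u\times\alpha_v\|}$ ($\epsilon=1$ where $EG-F^2<0$ fails to be satisfied with the opposite orientation, i.e. $\epsilon=\pm1$ is chosen so that $\det(\alpha_u,\alpha_v,N)>0$), $e=\langle\alpha_{uu},N\rangle$, $f=\langle\alpha_{uv},N\rangle$, $g=\langle\alpha_{vv},N\rangle$, $H=\frac{Eg+Ge-2Ff}{2(EG-F^2)}$, $K=\frac{eg-f^2}{EG-F^2}$. The principal curvatures are $H\pm\sqrt{H^2-K}$. The focal set of the surface (the singular set of the normal line congruence $\alpha+tN$) consists of the two sheets $$\mathcal{F}_i:\ \alpha(u,v)+\frac{1}{k_i(u,v)}N(u,v),\qquad i=1,2,$$ where $k_1,k_2$ are the two principal curvatures, labelled by the two families of principal directions (for the parametrization above, these are the $u$- and $v$-coordinate directions). At points where $EG-F^2=0$ the vector $N$ is not defined and $k_i$ is unbounded, and $\frac1{k_i}N$ is understood as its limit; the same convention applies at the points where the parametrization $\alpha$ is not regular. *)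

theory Defs
  imports "HOL-Analysis.Analysis"
begin

section \<open>Minkowski 3-space\<close>

definition mink :: "real^3 \<Rightarrow> real^3 \<Rightarrow> real" where
  "mink p q = p$1 * q$1 + p$2 * q$2 - p$3 * q$3"

definition mnorm :: "real^3 \<Rightarrow> real" where
  "mnorm p = sqrt \<bar>mink p p\<bar>"

definition mcross :: "real^3 \<Rightarrow> real^3 \<Rightarrow> real^3" where
  "mcross p q = (THE w. \<forall>r. mink w r = det (vector [p, q, r] :: real^3^3))"

lemma mcross_eq:
  "mcross p q = vector [p$2 * q$3 - p$3 * q$2, p$3 * q$1 - p$1 * q$3, p$2 * q$1 - p$1 * q$2]"
  unfolding mcross_def
proof (rule the_equality)
  show "\<forall>r. mink (vector [p$2 * q$3 - p$3 * q$2, p$3 * q$1 - p$1 * q$3, p$2 * q$1 - p$1 * q$2]) r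
      = det (vector [p, q, r] :: real^3^3)"
    by (simp add: mink_def det_3 algebra_simps)
next
  fix w :: "real^3"
  assume w: "\<forall>r. mink w r = det (vector [p, q, r] :: real^3^3)"
  show "w = vector [p$2 * q$3 - p$3 * q$2, p$3 * q$1 - p$1 * q$3, p$2 * q$1 - p$1 * q$2]"
    using w[rule_format, of "vector [1, 0, 0]"] w[rule_format, of "vector [0, 1, 0]"]
      w[rule_format, of "vector [0, 0, 1]"]
    by (simp add: mink_def det_3 vec_eq_iff forall_3 algebra_simps)
qed

lemma mink_mcross: "mink (mcross p q) r = det (vector [p, q, r] :: real^3^3)"
  by (simp add: mcross_eq mink_def det_3 algebra_simps)

section \<open>Fundamental forms of a parametrized surface\<close>

definition du :: "(real \<Rightarrow> real \<Rightarrow> real^3) \<Rightarrow> real \<Rightarrow> real \<Rightarrow> real^3" where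
  "du \<alpha> u v = vector_derivative (\<lambda>s. \<alpha> s v) (at u)"

definition dv :: "(real \<Rightarrow> real \<Rightarrow> real^3) \<Rightarrow> real \<Rightarrow> real \<Rightarrow> real^3" where
  "dv \<alpha> u v = vector_derivative (\<lambda>t. \<alpha> u t) (at v)"

definition coeff_E :: "(real \<Rightarrow> real \<Rightarrow> real^3) \<Rightarrow> real \<Rightarrow> real \<Rightarrow> real" where
  "coeff_E \<alpha> u v = mink (du \<alpha> u v) (du \<alpha> u v)"

definition coeff_F :: "(real \<Rightarrow> real \<Rightarrow> real^3) \<Rightarrow> real \<Rightarrow> real \<Rightarrow> real" where
  "coeff_F \<alpha> u v = mink (du \<alpha> u v) (dv \<alpha> u v)"

definition coeff_G :: "(real \<Rightarrow> real \<Rightarrow> real^3) \<Rightarrow> real \<Rightarrow> real \<Rightarrow> real" where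
  "coeff_G \<alpha> u v = mink (dv \<alpha> u v) (dv \<alpha> u v)"

definition disc :: "(real \<Rightarrow> real \<Rightarrow> real^3) \<Rightarrow> real \<Rightarrow> real \<Rightarrow> real" where
  "disc \<alpha> u v = coeff_E \<alpha> u v * coeff_G \<alpha> u v - (coeff_F \<alpha> u v)^2"

text \<open>The sign is the one for which \<open>du, dv, unit_normal\<close> is positively oriented,
  see \<open>unit_normal_oriented\<close>. Where \<open>disc = 0\<close> the value is 0 and carries no meaning.\<close>

definition unit_normal :: "(real \<Rightarrow> real \<Rightarrow> real^3) \<Rightarrow> real \<Rightarrow> real \<Rightarrow> real^3" where
  "unit_normal \<alpha> u v =
    (let w = mcross (du \<alpha> u v) (dv \<alpha> u v);
         \<epsilon> = (if det (vector [du \<alpha> u v, dv \<alpha> u v, w] :: real^3^3) > 0 then 1 else -1)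
     in (\<epsilon> / mnorm w) *\<^sub>R w)"

lemma mink_mcross_self:
  "mink (mcross p q) (mcross p q) = (mink p q)^2 - mink p p * mink q q"
  by (simp add: mcross_eq mink_def algebra_simps power2_eq_square)

lemma unit_normal_oriented:
  assumes "disc \<alpha> u v \<noteq> 0"
  shows "det (vector [du \<alpha> u v, dv \<alpha> u v, unit_normal \<alpha> u v] :: real^3^3) > 0"
proof -
  define w where "w = mcross (du \<alpha> u v) (dv \<alpha> u v)"
  have nz: "mink w w \<noteq> 0"
    using assms by (simp add: w_def mink_mcross_self disc_def coeff_E_def coeff_F_def coeff_G_def)
  have scale: "mink w (k *\<^sub>R w) = k * mink w w" for k
    by (simp add: mink_def algebra_simps)
  have det: "det (vector [du \<alpha> u v, dv \<alpha> u v, r] :: real^3^3) = mink w r" for r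
    by (simp add: w_def mink_mcross)
  have "mink w (unit_normal \<alpha> u v) = (if mink w w > 0 then 1 else -1) / mnorm w * mink w w"
    unfolding unit_normal_def Let_def w_def[symmetric] scale det ..
  also have "\<dots> > 0"
    using nz by (auto simp: mnorm_def divide_neg_pos mult_neg_neg)
  finally show ?thesis by (simp add: det)
qed

definition coeff_e :: "(real \<Rightarrow> real \<Rightarrow> real^3) \<Rightarrow> real \<Rightarrow> real \<Rightarrow> real" where
  "coeff_e \<alpha> u v = mink (du (du \<alpha>) u v) (unit_normal \<alpha> u v)"

definition coeff_f :: "(real \<Rightarrow> real \<Rightarrow> real^3) \<Rightarrow> real \<Rightarrow> real \<Rightarrow> real" where
  "coeff_f \<alpha> u v = mink (dv (du \<alpha>) u v) (unit_normal \<alpha> u v)"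

definition coeff_g :: "(real \<Rightarrow> real \<Rightarrow> real^3) \<Rightarrow> real \<Rightarrow> real \<Rightarrow> real" where
  "coeff_g \<alpha> u v = mink (dv (dv \<alpha>) u v) (unit_normal \<alpha> u v)"

definition mean_curvature :: "(real \<Rightarrow> real \<Rightarrow> real^3) \<Rightarrow> real \<Rightarrow> real \<Rightarrow> real" where
  "mean_curvature \<alpha> u v =
    (coeff_E \<alpha> u v * coeff_g \<alpha> u v + coeff_G \<alpha> u v * coeff_e \<alpha> u v
      - 2 * coeff_F \<alpha> u v * coeff_f \<alpha> u v) / (2 * disc \<alpha> u v)"

definition gauss_curvature :: "(real \<Rightarrow> real \<Rightarrow> real^3) \<Rightarrow> real \<Rightarrow> real \<Rightarrow> real" where
  "gauss_curvature \<alpha> u v =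
    (coeff_e \<alpha> u v * coeff_g \<alpha> u v - (coeff_f \<alpha> u v)^2) / disc \<alpha> u v"

section \<open>Principal curvatures and focal sheets\<close>

text \<open>The tangent vector \<open>w = x *\<^sub>R du + y *\<^sub>R dv\<close> is an eigenvector of the shape
  operator \<open>S = -dN\<close> with eigenvalue \<open>k\<close>; since \<open>II(w, _) = I(S w, _)\<close>, this reads
  \<open>II(w, _) = k I(w, _)\<close>, tested on \<open>du\<close> and \<open>dv\<close>.\<close>

definition principal_direction ::
  "(real \<Rightarrow> real \<Rightarrow> real^3) \<Rightarrow> real \<Rightarrow> real \<Rightarrow> real \<Rightarrow> real \<Rightarrow> real \<Rightarrow> bool" where
  "principal_direction \<alpha> u v k x y \<longleftrightarrow>
     (x, y) \<noteq> (0, 0) \<and>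
     coeff_e \<alpha> u v * x + coeff_f \<alpha> u v * y = k * (coeff_E \<alpha> u v * x + coeff_F \<alpha> u v * y) \<and>
     coeff_f \<alpha> u v * x + coeff_g \<alpha> u v * y = k * (coeff_F \<alpha> u v * x + coeff_G \<alpha> u v * y)"

text \<open>\<open>p\<close> and \<open>q\<close> are the two principal curvatures, \<open>p\<close> belonging to the \<open>u\<close>- and \<open>q\<close>
  to the \<open>v\<close>-coordinate direction. The condition \<open>0 \<le> H\<^sup>2 - K\<close> is needed because
  the shape operator of a timelike surface may have non-real eigenvalues, while \<open>sqrt\<close>
  is also defined on negative reals.\<close>

definition principal_curvatures_uv ::
  "(real \<Rightarrow> real \<Rightarrow> real^3) \<Rightarrow> (real \<Rightarrow> real \<Rightarrow> real) \<Rightarrow> (real \<Rightarrow> real \<Rightarrow> real) \<Rightarrow> bool" where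
  "principal_curvatures_uv \<alpha> p q \<longleftrightarrow>
     (\<forall>u v. disc \<alpha> u v \<noteq> 0 \<longrightarrow>
        (let H = mean_curvature \<alpha> u v; K = gauss_curvature \<alpha> u v in
           0 \<le> H^2 - K \<and>
           {p u v, q u v} = {H + sqrt (H^2 - K), H - sqrt (H^2 - K)}) \<and>
        principal_direction \<alpha> u v (p u v) 1 0 \<and>
        principal_direction \<alpha> u v (q u v) 0 1)"

text \<open>\<open>P\<close> is the point \<open>\<alpha>(u,v) + (1/k) N\<close> of the focal sheet of \<open>k\<close>. Where \<open>disc = 0\<close>
  (in particular where \<open>du, dv\<close> are linearly dependent) \<open>(1/k) N\<close> is its limit along the
  set \<open>disc \<noteq> 0\<close>. The conditions \<open>k u v \<noteq> 0\<close> and \<open>islimpt\<close> exclude the conventional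
  value \<open>1/0 = 0\<close> and a vacuous limit.\<close>

definition focal_point ::
  "(real \<Rightarrow> real \<Rightarrow> real^3) \<Rightarrow> (real \<Rightarrow> real \<Rightarrow> real) \<Rightarrow> real \<Rightarrow> real \<Rightarrow> real^3 \<Rightarrow> bool" where
  "focal_point \<alpha> k u v P \<longleftrightarrow>
     (let R = {(s, t). disc \<alpha> s t \<noteq> 0} in
      \<exists>w. P = \<alpha> u v + w \<and>
        (if (u, v) \<in> R then k u v \<noteq> 0 \<and> w = (1 / k u v) *\<^sub>R unit_normal \<alpha> u v
         else (u, v) islimpt R \<and>
           ((\<lambda>(s, t). (1 / k s t) *\<^sub>R unit_normal \<alpha> s t) \<longlongrightarrow> w) (at (u, v) within R)))"

section \<open>The ellipsoid\<close>

definition ellipsoid :: "real \<Rightarrow> real \<Rightarrow> real \<Rightarrow> (real^3) set" where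
  "ellipsoid a b c = {p. (p$1)^2 / a^2 + (p$2)^2 / b^2 + (p$3)^2 / c^2 = 1}"

definition ell_param :: "real \<Rightarrow> real \<Rightarrow> real \<Rightarrow> real \<Rightarrow> real \<Rightarrow> real^3" where
  "ell_param a b c u v = vector
     [a * cos u * sqrt ((a^2 - b^2) / (a^2 + c^2) * (cos v)^2 + (sin v)^2),
      b * sin u * sin v,
      c * cos v * sqrt ((b^2 + c^2) / (a^2 + c^2) * (cos u)^2 + (sin u)^2)]"

end

theory Submission
  imports Defs
begin

text \<open>
  Let \<open>Q = diag (1/a\<^sup>2, 1/b\<^sup>2, -1/c\<^sup>2)\<close>. It is self-adjoint for the Minkowski product, the form
  \<open>\<langle>p, Q p\<rangle>\<close> is positive definite, and the ellipsoid is \<open>\<langle>p, Q p\<rangle> = 1\<close>; hence \<open>\<nu> = Q \<alpha>\<close> is a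
  normal field of \<open>\<alpha>\<close> that is smooth everywhere, also where the unit normal is undefined.
  The two points of the theorem are \<open>\<alpha> + \<mu>\<^sub>1 \<nu>\<close> and \<open>\<alpha> + \<mu>\<^sub>2 \<nu>\<close> for multipliers \<open>\<mu>\<^sub>1\<close>, depending on
  \<open>u\<close> only, and \<open>\<mu>\<^sub>2\<close>, depending on \<open>v\<close> only (lemmas \<open>focal_formula_u\<close>, \<open>focal_formula_v\<close>). So it
  suffices to show that \<open>\<mu>\<^sub>i \<nu>\<close> equals \<open>(1/k\<^sub>i) N\<close> where \<open>N\<close> exists, that \<open>N\<close> exists on a dense
  set, and to pass to the limit by continuity of \<open>\<mu>\<^sub>i \<nu>\<close>.

  The geometric core is that the \<open>u\<close>-derivative of \<open>\<alpha> + \<mu>\<^sub>1 \<nu>\<close> and the \<open>v\<close>-derivative of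
  \<open>\<alpha> + \<mu>\<^sub>2 \<nu>\<close> are normal to the surface, as they must be at a focal point:
  \<open>(1 + \<mu>\<^sub>1 Q) \<alpha>\<^sub>u\<close> and \<open>(1 + \<mu>\<^sub>2 Q) \<alpha>\<^sub>v\<close> are multiples of \<open>\<nu>\<close> (lemmas \<open>focal_derivative_u\<close>,
  \<open>focal_derivative_v\<close>). Everything else is bilinear algebra. Pairing these identities with
  \<open>\<alpha>\<^sub>u\<close> and \<open>\<alpha>\<^sub>v\<close> gives
  \<open>E = - \<mu>\<^sub>1 \<langle>\<alpha>\<^sub>u, Q \<alpha>\<^sub>u\<rangle>\<close>, \<open>G = - \<mu>\<^sub>2 \<langle>\<alpha>\<^sub>v, Q \<alpha>\<^sub>v\<rangle>\<close> and
  \<open>F = - \<mu>\<^sub>1 \<langle>\<alpha>\<^sub>u, Q \<alpha>\<^sub>v\<rangle> = - \<mu>\<^sub>2 \<langle>\<alpha>\<^sub>u, Q \<alpha>\<^sub>v\<rangle>\<close>. Away from the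
  points with \<open>sin u = sin v = 0\<close> one has \<open>\<mu>\<^sub>1 < \<mu>\<^sub>2\<close>, and so the coordinate curves are both
  orthogonal (\<open>F = 0\<close>) and conjugate (\<open>\<langle>\<alpha>\<^sub>u, Q \<alpha>\<^sub>v\<rangle> = 0\<close>).
  Differentiating the tangency relations \<open>\<langle>\<alpha>\<^sub>u, \<nu>\<rangle> = \<langle>\<alpha>\<^sub>v, \<nu>\<rangle> = 0\<close> turns the second fundamental
  form into \<open>- \<langle>_, Q _\<rangle>\<close>. Hence, with \<open>N = h \<nu>\<close>, the coordinate directions are principal with
  curvatures \<open>e/E = h/\<mu>\<^sub>1\<close> and \<open>g/G = h/\<mu>\<^sub>2\<close>, and the unknown normalization and sign \<open>h\<close> cancels
  in \<open>(1/k\<^sub>i) N\<close>.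

  By positive definiteness \<open>EG - F\<^sup>2 = 0\<close> happens only where \<open>sin u = sin v = 0\<close> or \<open>\<mu>\<^sub>2 = 0\<close>. On
  each line \<open>u = const\<close> this is a countable set, so its complement is dense.

  That \<open>\<alpha>\<close> covers the ellipsoid is the existence of ellipsoidal coordinates, an application of
  the intermediate value theorem to \<open>cos\<^sup>2 v\<close> (lemma \<open>ellipsoidal_coordinates_exist_squared\<close>).
\<close>

section \<open>Calculus in three-dimensional coordinates\<close>

lemma has_vector_derivative_vector_3:
  fixes x y z :: "real \<Rightarrow> real"
  assumes "(x has_real_derivative x') (at t)" "(y has_real_derivative y') (at t)"
    "(z has_real_derivative z') (at t)"
  shows "((\<lambda>s. vector [x s, y s, z s] :: real^3) has_vector_derivative vector [x', y', z']) (at t)"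
proof -
  have expand: "(vector [p, q, r] :: real^3) = p *\<^sub>R axis 1 1 + q *\<^sub>R axis 2 1 + r *\<^sub>R axis 3 1"
    for p q r :: real
    by (simp add: vec_eq_iff forall_3 axis_def)
  show ?thesis
    unfolding expand using assms
    by (auto intro!: derivative_eq_intros)
qed

lemma has_real_derivative_vec_nth:
  fixes f :: "real \<Rightarrow> real^'n"
  assumes "(f has_vector_derivative f') (at t)"
  shows "((\<lambda>s. f s $ i) has_real_derivative f' $ i) (at t)"
  using bounded_linear.has_vector_derivative[OF bounded_linear_vec_nth assms, of i]
  by (simp add: has_real_derivative_iff_has_vector_derivative)

lemma tendsto_vector_3:
  fixes x y z :: "'a \<Rightarrow> real"
  assumes "(x \<longlongrightarrow> x0) F" "(y \<longlongrightarrow> y0) F" "(z \<longlongrightarrow> z0) F"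
  shows "((\<lambda>s. vector [x s, y s, z s] :: real^3) \<longlongrightarrow> vector [x0, y0, z0]) F"
proof (rule vec_tendstoI)
  fix i :: 3
  show "((\<lambda>s. (vector [x s, y s, z s] :: real^3) $ i) \<longlongrightarrow> (vector [x0, y0, z0] :: real^3) $ i) F"
    using exhaust_3[of i] assms by auto
qed

lemma differentiable_vector_3:
  fixes x y z :: "real \<Rightarrow> real"
  assumes "x differentiable (at t)" "y differentiable (at t)" "z differentiable (at t)"
  shows "(\<lambda>s. vector [x s, y s, z s] :: real^3) differentiable (at t)"
proof -
  obtain x' y' z' where "(x has_real_derivative x') (at t)" "(y has_real_derivative y') (at t)"
    "(z has_real_derivative z') (at t)"
    using assms unfolding real_differentiable_def by blast
  from has_vector_derivative_vector_3[OF this] show ?thesis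
    by (rule differentiableI_vector)
qed

lemma powr_three_halves:
  assumes "(x::real) \<ge> 0" shows "x powr (3/2) = x * sqrt x"
proof -
  have "x powr (1 + 1/2) = x powr 1 * x powr (1/2)"
    by (rule powr_add)
  then show ?thesis
    using assms by (simp add: powr_half_sqrt)
qed

section \<open>Orthogonal conjugate parametrizations\<close>

lemma mink_commute: "mink p q = mink q p"
  by (simp add: mink_def mult.commute)

lemma mink_add_left: "mink (p + q) r = mink p r + mink q r"
  by (simp add: mink_def algebra_simps)

lemma mink_scaleR_left: "mink (k *\<^sub>R p) r = k * mink p r"
  by (simp add: mink_def algebra_simps)

lemma mink_scaleR_right: "mink p (k *\<^sub>R r) = k * mink p r"
  by (simp add: mink_def algebra_simps)

text \<open>Both \<open>p\<close> and \<open>q\<close> lie in the plane orthogonal to \<open>n\<close>; if \<open>p \<times> q\<close> is nonzero, they span it and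
  \<open>p \<times> q\<close> is a normal of it. This identifies the direction of the unit normal of the ellipsoid without computing
  a vector product of partial derivatives.\<close>

lemma mcross_parallel_normal:
  assumes "mink p n = 0" "mink q n = 0" "n \<noteq> 0"
  obtains l where "mcross p q = l *\<^sub>R n"
proof -
  define w where "w = mcross p q"
  have w: "w$1 = p$2 * q$3 - p$3 * q$2" "w$2 = p$3 * q$1 - p$1 * q$3"
    "w$3 = p$2 * q$1 - p$1 * q$2"
    by (simp_all add: w_def mcross_eq)
  have p: "p$1 * n$1 + p$2 * n$2 = p$3 * n$3" and q: "q$1 * n$1 + q$2 * n$2 = q$3 * n$3"
    using assms by (simp_all add: mink_def)
  \<comment> \<open>The vector product of \<open>w\<close> and \<open>n\<close> vanishes: \<open>(p \<times> q) \<times> n\<close> is a combination of \<open>p\<close> and \<open>q\<close>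
    with coefficients \<open>\<langle>q, n\<rangle>\<close> and \<open>\<langle>p, n\<rangle>\<close>, up to sign.\<close>
  have "w$1 * n$2 = w$2 * n$1" "w$1 * n$3 = w$3 * n$1" "w$2 * n$3 = w$3 * n$2"
    using p[THEN arg_cong[where f="\<lambda>x. q$3 * x"]] q[THEN arg_cong[where f="\<lambda>x. p$3 * x"]]
      p[THEN arg_cong[where f="\<lambda>x. q$2 * x"]] q[THEN arg_cong[where f="\<lambda>x. p$2 * x"]]
      p[THEN arg_cong[where f="\<lambda>x. q$1 * x"]] q[THEN arg_cong[where f="\<lambda>x. p$1 * x"]]
    by (simp_all add: w algebra_simps)
  moreover have "n$1 \<noteq> 0 \<or> n$2 \<noteq> 0 \<or> n$3 \<noteq> 0"
    using assms(3) by (auto simp: vec_eq_iff forall_3)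
  ultimately have "w = (w$1 / n$1) *\<^sub>R n \<or> w = (w$2 / n$2) *\<^sub>R n \<or> w = (w$3 / n$3) *\<^sub>R n"
    by (auto simp: vec_eq_iff forall_3 eq_divide_eq)
  then show ?thesis using that unfolding w_def by blast
qed

text \<open>Both fundamental forms are diagonal, so the shape operator is diagonal with the eigenvalues
  \<open>e/E\<close> and \<open>g/G\<close>; then \<open>H\<^sup>2 - K\<close> is the square of half their difference, and its root is half
  the absolute difference.\<close>

lemma principal_curvatures_uv_of_orthogonal:
  assumes F: "\<And>u v. disc \<alpha> u v \<noteq> 0 \<Longrightarrow> coeff_F \<alpha> u v = 0"
    and f: "\<And>u v. disc \<alpha> u v \<noteq> 0 \<Longrightarrow> coeff_f \<alpha> u v = 0"
  shows "principal_curvatures_uv \<alpha> (\<lambda>u v. coeff_e \<alpha> u v / coeff_E \<alpha> u v)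
           (\<lambda>u v. coeff_g \<alpha> u v / coeff_G \<alpha> u v)"
  unfolding principal_curvatures_uv_def
proof (intro allI impI)
  fix u v assume R: "disc \<alpha> u v \<noteq> 0"
  define p q where "p = coeff_e \<alpha> u v / coeff_E \<alpha> u v" and "q = coeff_g \<alpha> u v / coeff_G \<alpha> u v"
  have EG: "coeff_E \<alpha> u v \<noteq> 0" "coeff_G \<alpha> u v \<noteq> 0"
    using R F[OF R] by (auto simp: disc_def)
  have H: "mean_curvature \<alpha> u v = (p + q) / 2"
    using EG F[OF R] by (simp add: mean_curvature_def disc_def p_def q_def field_simps)
  have K: "gauss_curvature \<alpha> u v = p * q"
    using EG F[OF R] f[OF R] by (simp add: gauss_curvature_def disc_def p_def q_def)
  have diff: "(mean_curvature \<alpha> u v)^2 - gauss_curvature \<alpha> u v = ((p - q) / 2)^2"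
    by (simp add: H K power2_eq_square field_simps)
  have "{p, q} = {(p + q) / 2 + \<bar>(p - q) / 2\<bar>, (p + q) / 2 - \<bar>(p - q) / 2\<bar>}"
  proof (cases "p \<le> q")
    case True
    then have "(p + q) / 2 + \<bar>(p - q) / 2\<bar> = q" "(p + q) / 2 - \<bar>(p - q) / 2\<bar> = p"
      by (simp_all add: field_simps)
    then show ?thesis by auto
  next
    case False
    then have "(p + q) / 2 + \<bar>(p - q) / 2\<bar> = p" "(p + q) / 2 - \<bar>(p - q) / 2\<bar> = q"
      by (simp_all add: field_simps)
    then show ?thesis by auto
  qed
  moreover have "principal_direction \<alpha> u v p 1 0" "principal_direction \<alpha> u v q 0 1"
    using EG F[OF R] f[OF R] by (simp_all add: principal_direction_def p_def q_def)
  ultimately show "(let H = mean_curvature \<alpha> u v; K = gauss_curvature \<alpha> u v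
      in 0 \<le> H\<^sup>2 - K \<and> {p, q} = {H + sqrt (H\<^sup>2 - K), H - sqrt (H\<^sup>2 - K)}) \<and>
      principal_direction \<alpha> u v p 1 0 \<and> principal_direction \<alpha> u v q 0 1"
    unfolding Let_def diff by (simp add: H)
qed

text \<open>A continuous field \<open>W\<close> that agrees with \<open>(1/k) N\<close> on a dense set of regular points handles the
  regular points and the limit points of the definition at once.\<close>

lemma focal_point_of_continuous_extension:
  assumes on: "\<And>s t. disc \<alpha> s t \<noteq> 0 \<Longrightarrow> k s t \<noteq> 0 \<and> (1 / k s t) *\<^sub>R unit_normal \<alpha> s t = W s t"
    and lim: "((\<lambda>(s, t). W s t) \<longlongrightarrow> W u v) (at (u, v))"
    and limpt: "(u, v) islimpt {(s, t). disc \<alpha> s t \<noteq> 0}"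
  shows "focal_point \<alpha> k u v (\<alpha> u v + W u v)"
proof -
  define R where "R = {(s, t). disc \<alpha> s t \<noteq> 0}"
  have "((\<lambda>(s, t). (1 / k s t) *\<^sub>R unit_normal \<alpha> s t) \<longlongrightarrow> W u v) (at (u, v) within R)"
  proof (rule Lim_transform_eventually)
    show "((\<lambda>(s, t). W s t) \<longlongrightarrow> W u v) (at (u, v) within R)"
      using lim by (rule tendsto_within_subset) simp
    show "\<forall>\<^sub>F x in at (u, v) within R. (\<lambda>(s, t). W s t) x
        = (\<lambda>(s, t). (1 / k s t) *\<^sub>R unit_normal \<alpha> s t) x"
      using on by (auto simp: R_def eventually_at_filter intro!: always_eventually)
  qed
  then show ?thesis
    unfolding focal_point_def Let_def R_def[symmetric]
    using limpt on by (intro exI[of _ "W u v"]) (auto simp: R_def)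
qed

section \<open>Density of the complement of a sine level set\<close>

lemma countable_sin_level: "countable {t. sin t = (y::real)}"
proof (cases "\<exists>x. y = sin x")
  case True
  then obtain x where x: "y = sin x" ..
  have "{t. sin t = y} \<subseteq> (\<Union>n\<in>\<int>. {x + 2*n*pi, -x + (2*n + 1)*pi})"
    by (auto simp: x sin_eq)
  moreover have "countable (\<int> :: real set)"
    by (simp add: Ints_def)
  then have "countable (\<Union>n\<in>(\<int> :: real set). {x + 2*n*pi, -x + (2*n + 1)*pi})"
    by (rule countable_UN) simp
  ultimately show ?thesis
    by (rule countable_subset)
next
  case False
  then have "{t. sin t = y} = {}" by auto
  then show ?thesis by (simp only: countable_empty)
qed

text \<open>Moving the second coordinate alone already reaches \<open>R\<close>, because a real interval is uncountable.\<close>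

lemma islimpt_countable_fibre:
  fixes u v :: real
  assumes "countable {t. (u, t) \<notin> R}"
  shows "(u, v) islimpt R"
  unfolding islimpt_approachable
proof (intro allI impI)
  fix e :: real assume "e > 0"
  then have "\<not> {v<..<v+e} \<subseteq> {t. (u, t) \<notin> R}"
    using assms countable_subset uncountable_open_interval[of v "v+e"] by auto
  then obtain t where "v < t" "t < v + e" "(u, t) \<in> R" by auto
  then show "\<exists>x'\<in>R. x' \<noteq> (u, v) \<and> dist x' (u, v) < e"
    by (intro bexI[of _ "(u, t)"]) (auto simp: dist_Pair_Pair dist_real_def)
qed

section \<open>Existence of ellipsoidal coordinates\<close>

text \<open>The square roots in the parametrization. The two parameters \<open>k\<close> that occur add up to 1.\<close>

definition ell_radical :: "real \<Rightarrow> real \<Rightarrow> real" where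
  "ell_radical k x = sqrt (k * (cos x)^2 + (sin x)^2)"

lemma ell_radical_arg_pos: "k > 0 \<Longrightarrow> k * (cos x)^2 + (sin x)^2 > (0::real)"
proof (cases "sin x = 0")
  case True
  then have "(cos x)^2 = 1" using sin_cos_squared_add[of x] by simp
  then show "k > 0 \<Longrightarrow> ?thesis" using True by simp
qed (simp add: add_nonneg_pos)

lemma ell_radical_pos: "k > 0 \<Longrightarrow> ell_radical k x > 0"
  by (simp add: ell_radical_def ell_radical_arg_pos)

lemma ell_radical_squared: "k > 0 \<Longrightarrow> (ell_radical k x)^2 = k * (cos x)^2 + (sin x)^2"
  using ell_radical_arg_pos[of k x] by (simp add: ell_radical_def)

lemma DERIV_ell_radical:
  assumes "k > 0"
  shows "(ell_radical k has_real_derivative (1 - k) * sin x * cos x / ell_radical k x) (at x)"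
proof -
  have "((\<lambda>x. k * (cos x)^2 + (sin x)^2) has_real_derivative 2 * ((1 - k) * sin x * cos x)) (at x)"
    by (auto intro!: derivative_eq_intros simp: algebra_simps)
  from DERIV_chain2[OF DERIV_real_sqrt[OF ell_radical_arg_pos[OF assms]] this]
  have "(ell_radical k has_real_derivative
      inverse (ell_radical k x) / 2 * (2 * ((1 - k) * sin x * cos x))) (at x)"
    unfolding ell_radical_def[abs_def] .
  then show ?thesis
    by (rule DERIV_cong) (simp add: inverse_eq_divide)
qed

lemma DERIV_ell_radical_compose [derivative_intros]:
  assumes "(f has_real_derivative f') (at x within S)" "k > 0"
  shows "((\<lambda>x. ell_radical k (f x)) has_real_derivative
    (1 - k) * sin (f x) * cos (f x) / ell_radical k (f x) * f') (at x within S)"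
  using DERIV_chain2[OF DERIV_ell_radical[OF assms(2)] assms(1)] .

lemma continuous_ell_radical: "isCont (ell_radical k) x"
  unfolding ell_radical_def[abs_def] by (intro continuous_intros)

text \<open>Here \<open>x, y, z\<close> are the squares of the coordinates of a point of the unit sphere, and
  \<open>p = cos\<^sup>2 u\<close>, \<open>q = cos\<^sup>2 v\<close>. The first equation determines \<open>p\<close> as a nondecreasing function \<open>P\<close> of
  \<open>q\<close>; substituted into the second one, it leaves one equation \<open>Z q = z\<close>, to be solved by the
  intermediate value theorem. The third equation follows from the others. The search for \<open>q\<close> is
  confined to those values at which \<open>P q \<le> 1\<close>: on all of \<open>{0..1}\<close> a root with \<open>P q > 1\<close> can occur.\<close>

lemma ellipsoidal_coordinates_exist_squared:
  fixes k x y z :: real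
  assumes k: "0 < k" "k < 1" and sphere: "x + y + z = 1" and nonneg: "0 \<le> x" "0 \<le> y" "0 \<le> z"
  obtains p q where "0 \<le> p" "p \<le> 1" "0 \<le> q" "q \<le> 1"
    "p * (1 - k * q) = x" "q * (1 - (1 - k) * p) = z" "(1 - p) * (1 - q) = y"
proof -
  \<comment> \<open>The largest admissible \<open>q\<close>: \<open>P q \<le> 1\<close> means \<open>k * q \<le> 1 - x\<close>.\<close>
  define q1 where "q1 = min 1 ((1 - x) / k)"
  define P where "P q = x / (1 - k * q)" for q
  define Z where "Z q = q * (1 - (1 - k) * P q)" for q
  have "q1 \<le> (1 - x) / k" and q1: "0 \<le> q1" "q1 \<le> 1"
    using k sphere nonneg by (simp_all add: q1_def)
  then have kq1: "k * q1 \<le> 1 - x"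
    using k by (simp add: pos_le_divide_eq mult.commute)
  have pos: "0 < 1 - k * q" if "q \<le> q1" for q
  proof -
    have "k * q \<le> k" using mult_left_mono[of q 1 k] that q1 k by simp
    then show ?thesis using k by linarith
  qed
  have "continuous_on {0..q1} Z"
    unfolding Z_def P_def using pos by (intro continuous_intros) (auto simp: less_le)
  moreover have "Z 0 \<le> z"
    using nonneg by (simp add: Z_def)
  \<comment> \<open>At the right end either \<open>P q1 = 1\<close> or \<open>q1 = 1\<close>; both give \<open>Z q1 = 1 - x = y + z\<close>.\<close>
  moreover have "z \<le> Z q1"
  proof (cases "1 - x \<le> k")
    case True
    then have q: "q1 = (1 - x) / k" using k by (simp add: q1_def min_def)
    then have "P q1 = 1 \<or> x = 0"
      using k by (simp add: P_def)
    moreover have "x \<noteq> 0" using True k by auto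
    ultimately have "Z q1 = 1 - x" using q k by (simp add: Z_def)
    then show ?thesis using sphere nonneg by simp
  next
    case False
    then have "q1 = 1" using k by (simp add: q1_def min_def field_simps)
    then have "Z q1 = 1 - x" using k by (simp add: Z_def P_def)
    then show ?thesis using sphere nonneg by simp
  qed
  ultimately obtain q where q: "0 \<le> q" "q \<le> q1" "Z q = z"
    using IVT'[of Z 0 z q1] q1 by auto
  have "k * q \<le> k * q1" using q k by (intro mult_left_mono) simp_all
  then have "x \<le> 1 - k * q" using kq1 by simp
  then have P: "0 \<le> P q" "P q \<le> 1" "P q * (1 - k * q) = x"
    using pos[OF q(2)] nonneg by (auto simp: P_def)
  have z: "q * (1 - (1 - k) * P q) = z" using q by (simp add: Z_def)
  have "(1 - P q) * (1 - q) = 1 - P q * (1 - k * q) - q * (1 - (1 - k) * P q)"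
    by (simp add: algebra_simps)
  also have "\<dots> = y" using P(3) z sphere by simp
  finally show ?thesis using that[of "P q" q] P z q q1 by simp
qed

text \<open>The squared equations fix \<open>cos u\<close>, \<open>cos v\<close>, \<open>sin u\<close> and \<open>sin v\<close> up to sign. The signs of \<open>x\<close> and
  \<open>z\<close> are given to the cosines and that of \<open>y\<close> to \<open>sin v\<close>, while \<open>sin u\<close> is taken nonnegative.\<close>

lemma ellipsoidal_coordinates_exist:
  fixes k x y z :: real
  assumes k: "0 < k" "k < 1" and sphere: "x^2 + y^2 + z^2 = 1"
  obtains u v where "cos u * ell_radical (1 - k) v = x" "sin u * sin v = y" "cos v * ell_radical k u = z"
proof -
  obtain p q where pq: "0 \<le> p" "p \<le> 1" "0 \<le> q" "q \<le> 1"
    "p * (1 - k * q) = x^2" "q * (1 - (1 - k) * p) = z^2" "(1 - p) * (1 - q) = y^2"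
    using ellipsoidal_coordinates_exist_squared[OF k sphere] by auto
  \<comment> \<open>A sign that is never 0, so that its square is always 1.\<close>
  define sg :: "real \<Rightarrow> real" where "sg r = (if r < 0 then -1 else 1)" for r
  have sg: "(sg r)^2 = 1" "sg r * \<bar>r\<bar> = r" for r by (simp_all add: sg_def)
  have "(sg x * sqrt p)^2 + (sqrt (1 - p))^2 = 1"
    using pq by (simp add: power_mult_distrib sg)
  then obtain u where u: "sg x * sqrt p = cos u" "sqrt (1 - p) = sin u"
    by (rule sincos_total_2pi)
  have "(sg z * sqrt q)^2 + (sg y * sqrt (1 - q))^2 = 1"
    using pq by (simp add: power_mult_distrib sg)
  then obtain v where v: "sg z * sqrt q = cos v" "sg y * sqrt (1 - q) = sin v"
    by (rule sincos_total_2pi)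
  have "(1 - k) * (cos v)^2 + (sin v)^2 = 1 - k * q"
    using pq by (simp add: v[symmetric] power_mult_distrib sg algebra_simps)
  then have "cos u * ell_radical (1 - k) v = sg x * sqrt (p * (1 - k * q))"
    by (simp add: ell_radical_def u(1)[symmetric] real_sqrt_mult)
  moreover have "k * (cos u)^2 + (sin u)^2 = 1 - (1 - k) * p"
    using pq by (simp add: u[symmetric] power_mult_distrib sg algebra_simps)
  then have "cos v * ell_radical k u = sg z * sqrt (q * (1 - (1 - k) * p))"
    by (simp add: ell_radical_def v(1)[symmetric] real_sqrt_mult)
  moreover have "sin u * sin v = sg y * sqrt ((1 - p) * (1 - q))"
    by (simp add: u(2)[symmetric] v(2)[symmetric] real_sqrt_mult)
  ultimately show ?thesis
    using that[of u v] unfolding pq(5-7) by (simp add: sg)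
qed

section \<open>The ellipsoid and its conormal\<close>

locale ellipsoid_axes =
  fixes a b c :: real
  assumes ab: "a > b" and b_pos: "b > 0" and c_pos: "c > 0"
begin

abbreviation \<alpha> :: "real \<Rightarrow> real \<Rightarrow> real^3" where "\<alpha> \<equiv> ell_param a b c"

definition \<kappa> :: real where "\<kappa> = (b^2 + c^2) / (a^2 + c^2)"

definition \<psi> :: "real \<Rightarrow> real" where "\<psi> = ell_radical \<kappa>"

definition \<phi> :: "real \<Rightarrow> real" where "\<phi> = ell_radical (1 - \<kappa>)"

lemma a_pos: "a > 0"
  using ab b_pos by simp

lemma sq_diff_pos: "a^2 - b^2 > 0"
  using ab b_pos by (simp add: power_strict_mono)

lemma sq_sums_pos: "b^2 + c^2 > 0" "a^2 + c^2 > 0"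
  using a_pos b_pos c_pos by (simp_all add: add_pos_pos)

lemma one_minus_kappa: "1 - \<kappa> = (a^2 - b^2) / (a^2 + c^2)"
  using a_pos by (simp add: \<kappa>_def field_simps)

lemma kappa_scaled: "(a^2 + c^2) * \<kappa> = b^2 + c^2" "(a^2 + c^2) * (1 - \<kappa>) = a^2 - b^2"
  unfolding one_minus_kappa using a_pos by (simp_all add: \<kappa>_def)

lemma kappa_bounds: "0 < \<kappa>" "\<kappa> < 1"
  using sq_sums_pos sq_diff_pos by (simp_all add: \<kappa>_def)

lemma phi_pos: "\<phi> v > 0" and psi_pos: "\<psi> u > 0"
  using kappa_bounds by (simp_all add: \<phi>_def \<psi>_def ell_radical_pos)

lemma psi_squared: "(\<psi> u)^2 = \<kappa> * (cos u)^2 + (sin u)^2"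
  and phi_squared: "(\<phi> v)^2 = (1 - \<kappa>) * (cos v)^2 + (sin v)^2"
  using kappa_bounds by (simp_all add: \<phi>_def \<psi>_def ell_radical_squared)

lemma psi_squared_scaled:
  "(a^2 + c^2) * (\<psi> u)^2 = (b^2 + c^2) * (cos u)^2 + (a^2 + c^2) * (sin u)^2"
  unfolding psi_squared distrib_left mult.assoc[symmetric] kappa_scaled ..

lemma phi_squared_scaled:
  "(a^2 + c^2) * (\<phi> v)^2 = (a^2 - b^2) * (cos v)^2 + (a^2 + c^2) * (sin v)^2"
  unfolding phi_squared distrib_left mult.assoc[symmetric] kappa_scaled ..

lemma ell_param_eq:
  "\<alpha> u v = vector [a * cos u * \<phi> v, b * sin u * sin v, c * cos v * \<psi> u]"
  unfolding ell_param_def \<phi>_def \<psi>_def ell_radical_def one_minus_kappa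
  unfolding \<kappa>_def ..

lemma DERIV_psi [derivative_intros]:
  "(f has_real_derivative f') (at x within S) \<Longrightarrow>
   ((\<lambda>x. \<psi> (f x)) has_real_derivative (1 - \<kappa>) * sin (f x) * cos (f x) / \<psi> (f x) * f') (at x within S)"
  using DERIV_ell_radical_compose[OF _ kappa_bounds(1)] by (simp add: \<psi>_def)

lemma DERIV_phi [derivative_intros]:
  "(f has_real_derivative f') (at x within S) \<Longrightarrow>
   ((\<lambda>x. \<phi> (f x)) has_real_derivative \<kappa> * sin (f x) * cos (f x) / \<phi> (f x) * f') (at x within S)"
  using DERIV_ell_radical_compose[of f f' x S "1 - \<kappa>"] kappa_bounds by (simp add: \<phi>_def)

lemma range_ell_param: "range (\<lambda>(u, v). \<alpha> u v) = ellipsoid a b c"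
proof (intro equalityI subsetI)
  fix p assume "p \<in> range (\<lambda>(u, v). \<alpha> u v)"
  then obtain u v where p: "p = \<alpha> u v" by auto
  have "(p$1)^2 / a^2 + (p$2)^2 / b^2 + (p$3)^2 / c^2
      = (cos u)^2 * (\<phi> v)^2 + (sin u)^2 * (sin v)^2 + (cos v)^2 * (\<psi> u)^2"
    using a_pos b_pos c_pos by (simp add: p ell_param_eq power_mult_distrib)
  also have "\<dots> = 1"
    unfolding phi_squared psi_squared sin_squared_eq by (simp add: algebra_simps)
  finally show "p \<in> ellipsoid a b c" by (simp add: ellipsoid_def)
next
  fix p assume "p \<in> ellipsoid a b c"
  then have "(p$1 / a)^2 + (p$2 / b)^2 + (p$3 / c)^2 = 1"
    by (simp add: ellipsoid_def power_divide)
  then obtain u v where "cos u * \<phi> v = p$1 / a" "sin u * sin v = p$2 / b" "cos v * \<psi> u = p$3 / c"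
    unfolding \<phi>_def \<psi>_def by (rule ellipsoidal_coordinates_exist[OF kappa_bounds])
  then have "p = \<alpha> u v"
    using a_pos b_pos c_pos by (simp add: ell_param_eq vec_eq_iff forall_3 field_simps)
  then show "p \<in> range (\<lambda>(u, v). \<alpha> u v)" by auto
qed

text \<open>Half the Minkowski gradient of the quadratic form \<open>x\<^sup>2/a\<^sup>2 + y\<^sup>2/b\<^sup>2 + z\<^sup>2/c\<^sup>2\<close>. Since this gradient
  is linear in the point, \<open>Q\<close> gives both the normal \<open>\<nu> = Q \<alpha>\<close> and its derivatives.\<close>

definition Q :: "real^3 \<Rightarrow> real^3" where
  "Q p = vector [p$1 / a^2, p$2 / b^2, - (p$3 / c^2)]"

lemma mink_Q: "mink p (Q q) = p$1 * q$1 / a^2 + p$2 * q$2 / b^2 + p$3 * q$3 / c^2"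
  by (simp add: mink_def Q_def)

lemma mink_Q_symmetric: "mink p (Q q) = mink q (Q p)"
  by (simp add: mink_Q mult.commute)

lemma mink_Q_pos:
  assumes "p \<noteq> 0" shows "mink p (Q p) > 0"
proof -
  have eq: "mink p (Q p) = (p$1 / a)^2 + (p$2 / b)^2 + (p$3 / c)^2"
    by (simp add: mink_Q power2_eq_square)
  have "p$1 / a \<noteq> 0 \<or> p$2 / b \<noteq> 0 \<or> p$3 / c \<noteq> 0"
    using assms a_pos b_pos c_pos by (auto simp: vec_eq_iff forall_3)
  then have "0 < (p$1 / a)^2 \<or> 0 < (p$2 / b)^2 \<or> 0 < (p$3 / c)^2"
    by (simp only: zero_less_power2)
  then show ?thesis
    unfolding eq using zero_le_power2[of "p$1 / a"] zero_le_power2[of "p$2 / b"]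
      zero_le_power2[of "p$3 / c"] by linarith
qed

lemma mink_Q_ell_param: "mink (\<alpha> u v) (Q (\<alpha> u v)) = 1"
proof -
  have "\<alpha> u v \<in> ellipsoid a b c"
    using range_ell_param by auto
  then show ?thesis
    by (simp add: ellipsoid_def mink_Q power2_eq_square)
qed

text \<open>The product rule for a vanishing pairing. With \<open>g = \<alpha>\<close> along a coordinate curve and \<open>f\<close> a partial
  derivative of \<open>\<alpha>\<close>, it expresses second derivatives of \<open>\<alpha>\<close> in the normal direction by first
  derivatives.\<close>

lemma conormal_derivative:
  assumes f: "f differentiable (at t)" and g: "(g has_vector_derivative g') (at t)"
    and orth: "\<And>s. mink (f s) (Q (g s)) = 0"
  shows "mink (vector_derivative f (at t)) (Q (g t)) = - mink (f t) (Q g')"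
proof -
  note F = has_real_derivative_vec_nth[OF f[unfolded vector_derivative_works]]
    and G = has_real_derivative_vec_nth[OF g]
  let ?f' = "vector_derivative f (at t)"
  have "((\<lambda>s. f s$1 * g s$1 / a^2 + f s$2 * g s$2 / b^2 + f s$3 * g s$3 / c^2)
      has_real_derivative
        (?f'$1 * g t$1 + g'$1 * f t$1) / a^2 + (?f'$2 * g t$2 + g'$2 * f t$2) / b^2
          + (?f'$3 * g t$3 + g'$3 * f t$3) / c^2) (at t)"
    by (intro DERIV_add DERIV_cdivide DERIV_mult F G)
  then have "((\<lambda>s. 0) has_real_derivative
        (?f'$1 * g t$1 + g'$1 * f t$1) / a^2 + (?f'$2 * g t$2 + g'$2 * f t$2) / b^2
          + (?f'$3 * g t$3 + g'$3 * f t$3) / c^2) (at t)"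
    using orth by (simp add: mink_Q)
  from DERIV_unique[OF this DERIV_const]
  show ?thesis
    by (simp add: mink_Q add_divide_distrib mult.commute)
qed

lemma ell_param_du:
  "((\<lambda>s. \<alpha> s v) has_vector_derivative vector
     [- (a * sin u * \<phi> v), b * cos u * sin v, c * cos v * ((1 - \<kappa>) * sin u * cos u / \<psi> u)]) (at u)"
  unfolding ell_param_eq
  by (rule has_vector_derivative_vector_3; rule DERIV_cong, (rule derivative_intros)+, simp)

lemma ell_param_dv:
  "((\<lambda>t. \<alpha> u t) has_vector_derivative vector
     [a * cos u * (\<kappa> * sin v * cos v / \<phi> v), b * sin u * cos v, - (c * sin v * \<psi> u)]) (at v)"
  unfolding ell_param_eq
  by (rule has_vector_derivative_vector_3; rule DERIV_cong, (rule derivative_intros)+, simp)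

lemma du_eq:
  "du \<alpha> u v = vector
     [- (a * sin u * \<phi> v), b * cos u * sin v, c * cos v * ((1 - \<kappa>) * sin u * cos u / \<psi> u)]"
  unfolding du_def by (rule vector_derivative_at[OF ell_param_du])

lemma dv_eq:
  "dv \<alpha> u v = vector
     [a * cos u * (\<kappa> * sin v * cos v / \<phi> v), b * sin u * cos v, - (c * sin v * \<psi> u)]"
  unfolding dv_def by (rule vector_derivative_at[OF ell_param_dv])

lemma differentiable_trig: "sin differentiable (at (t::real))" "cos differentiable (at (t::real))"
  "\<phi> differentiable (at t)" "\<psi> differentiable (at t)"
  using DERIV_sin DERIV_cos DERIV_phi[OF DERIV_ident] DERIV_psi[OF DERIV_ident]
  unfolding real_differentiable_def by blast+

lemma second_partials_exist:
  "(\<lambda>s. du \<alpha> s v) differentiable (at u)"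
  "(\<lambda>t. du \<alpha> u t) differentiable (at v)"
  "(\<lambda>t. dv \<alpha> u t) differentiable (at v)"
  unfolding du_eq dv_eq using phi_pos[of v] psi_pos[of u]
  by (auto intro!: differentiable_vector_3 derivative_intros differentiable_trig)

section \<open>The two focal multipliers\<close>

abbreviation \<nu> :: "real \<Rightarrow> real \<Rightarrow> real^3" where "\<nu> u v \<equiv> Q (\<alpha> u v)"

text \<open>The multipliers for which \<open>\<alpha> + \<mu>\<^sub>1 \<nu>\<close> and \<open>\<alpha> + \<mu>\<^sub>2 \<nu>\<close> are the focal points. Their negatives are
  the parameters of the two further quadrics through \<open>\<alpha>\<close> of the confocal family
  \<open>x\<^sup>2/(a\<^sup>2 - t) + y\<^sup>2/(b\<^sup>2 - t) + z\<^sup>2/(c\<^sup>2 + t) = 1\<close>.\<close>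

definition \<mu>\<^sub>1 :: "real \<Rightarrow> real" where "\<mu>\<^sub>1 u = (a^2 - b^2) * (cos u)^2 - a^2"

definition \<mu>\<^sub>2 :: "real \<Rightarrow> real" where "\<mu>\<^sub>2 v = (b^2 + c^2) * (sin v)^2 - b^2"

text \<open>The three coordinates of \<open>p + \<mu>\<^sub>1 Q p\<close> carry the factors \<open>(a\<^sup>2 + \<mu>\<^sub>1)/a\<^sup>2\<close>, \<open>(b\<^sup>2 + \<mu>\<^sub>1)/b\<^sup>2\<close>,
  \<open>(c\<^sup>2 - \<mu>\<^sub>1)/c\<^sup>2\<close>, and the closed forms of the focal sheets rest on the factorization of the
  numerators.\<close>

lemma mu1_shifts:
  "a^2 + \<mu>\<^sub>1 u = (a^2 - b^2) * (cos u)^2"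
  "b^2 + \<mu>\<^sub>1 u = - ((a^2 - b^2) * (sin u)^2)"
  "c^2 - \<mu>\<^sub>1 u = (a^2 + c^2) * (\<psi> u)^2"
  unfolding \<mu>\<^sub>1_def psi_squared_scaled by (simp_all add: sin_squared_eq algebra_simps)

lemma mu2_shifts:
  "a^2 + \<mu>\<^sub>2 v = (a^2 + c^2) * (\<phi> v)^2"
  "b^2 + \<mu>\<^sub>2 v = (b^2 + c^2) * (sin v)^2"
  "c^2 - \<mu>\<^sub>2 v = (b^2 + c^2) * (cos v)^2"
  unfolding \<mu>\<^sub>2_def phi_squared_scaled by (simp_all add: sin_squared_eq algebra_simps)

lemma mu1_neg: "\<mu>\<^sub>1 u < 0"
proof -
  have "\<mu>\<^sub>1 u = - ((a^2 - b^2) * (sin u)^2) - b^2"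
    using mu1_shifts(2)[of u] by simp
  moreover have "(a^2 - b^2) * (sin u)^2 \<ge> 0"
    using sq_diff_pos by simp
  moreover have "b^2 > 0"
    using b_pos by simp
  ultimately show ?thesis by linarith
qed

lemma mu_difference: "\<mu>\<^sub>2 v - \<mu>\<^sub>1 u = (a^2 - b^2) * (sin u)^2 + (b^2 + c^2) * (sin v)^2"
  using mu1_shifts(2)[of u] mu2_shifts(2)[of v] by linarith

lemma mu_distinct:
  assumes "sin u \<noteq> 0 \<or> sin v \<noteq> 0" shows "\<mu>\<^sub>1 u < \<mu>\<^sub>2 v"
proof -
  have "(a^2 - b^2) * (sin u)^2 + (b^2 + c^2) * (sin v)^2 > 0"
    using assms sq_diff_pos sq_sums_pos by (auto intro: add_pos_nonneg add_nonneg_pos)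
  then show ?thesis using mu_difference[of v u] by linarith
qed

lemma add_scaled_Q:
  "p + k *\<^sub>R Q p = vector [(a^2 + k) * (p$1 / a^2), (b^2 + k) * (p$2 / b^2), (c^2 - k) * (p$3 / c^2)]"
  using a_pos b_pos c_pos by (simp add: Q_def vec_eq_iff forall_3 field_simps)

text \<open>The \<open>u\<close>-derivative of \<open>\<alpha> + \<mu>\<^sub>1 \<nu>\<close> is the left-hand side plus a multiple of \<open>\<nu>\<close>, so it is normal:
  along a \<open>u\<close>-curve the point \<open>\<alpha> + \<mu>\<^sub>1 \<nu>\<close> stays on consecutive normal lines. The third
  coordinate has the same factor as the others because \<open>c\<^sup>2 - \<mu>\<^sub>1\<close> is a multiple of \<open>\<psi>\<^sup>2\<close>, which
  cancels the \<open>\<psi>\<close> in the denominator of the derivative.\<close>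

lemma focal_derivative_u:
  "du \<alpha> u v + \<mu>\<^sub>1 u *\<^sub>R Q (du \<alpha> u v) = - ((a^2 - b^2) * sin u * cos u) *\<^sub>R \<nu> u v"
proof -
  have third: "(a^2 + c^2) * (\<psi> u)^2 * (c * cos v * ((1 - \<kappa>) * sin u * cos u / \<psi> u) / c^2)
      = (a^2 - b^2) * sin u * cos u * (cos v * \<psi> u / c)"
    unfolding kappa_scaled(2)[symmetric] using psi_pos[of u] c_pos
    by (simp add: power2_eq_square)
  show ?thesis
    unfolding add_scaled_Q mu1_shifts
    using a_pos b_pos c_pos third
    by (simp add: du_eq Q_def ell_param_eq vec_eq_iff forall_3 power2_eq_square)
qed

text \<open>Here it is the first coordinate that has a denominator, cancelled by \<open>a\<^sup>2 + \<mu>\<^sub>2\<close>, a multiple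
  of \<open>\<phi>\<^sup>2\<close>.\<close>

lemma focal_derivative_v:
  "dv \<alpha> u v + \<mu>\<^sub>2 v *\<^sub>R Q (dv \<alpha> u v) = ((b^2 + c^2) * sin v * cos v) *\<^sub>R \<nu> u v"
proof -
  have first: "(a^2 + c^2) * (\<phi> v)^2 * (a * cos u * (\<kappa> * sin v * cos v / \<phi> v) / a^2)
      = (b^2 + c^2) * sin v * cos v * (cos u * \<phi> v / a)"
    unfolding kappa_scaled(1)[symmetric] using phi_pos[of v] a_pos
    by (simp add: power2_eq_square)
  show ?thesis
    unfolding add_scaled_Q mu2_shifts
    using a_pos b_pos c_pos first
    by (simp add: dv_eq Q_def ell_param_eq vec_eq_iff forall_3 power2_eq_square)
qed

lemma du_tangent: "mink (du \<alpha> u v) (\<nu> u v) = 0"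
proof -
  have third: "c * cos v * ((1 - \<kappa>) * sin u * cos u / \<psi> u) * (c * cos v * \<psi> u) / c^2
      = (1 - \<kappa>) * (cos v)^2 * sin u * cos u"
    using psi_pos[of u] c_pos by (simp add: power2_eq_square)
  have "mink (du \<alpha> u v) (\<nu> u v)
      = - (sin u * cos u * (\<phi> v)^2) + sin u * cos u * (sin v)^2 + (1 - \<kappa>) * (cos v)^2 * sin u * cos u"
    using a_pos b_pos third
    by (simp add: mink_Q du_eq ell_param_eq power2_eq_square)
  also have "\<dots> = 0"
    unfolding phi_squared sin_squared_eq by (simp add: algebra_simps)
  finally show ?thesis .
qed

lemma dv_tangent: "mink (dv \<alpha> u v) (\<nu> u v) = 0"
proof -
  have first: "a * cos u * (\<kappa> * sin v * cos v / \<phi> v) * (a * cos u * \<phi> v) / a^2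
      = \<kappa> * (cos u)^2 * sin v * cos v"
    using phi_pos[of v] a_pos by (simp add: power2_eq_square)
  have "mink (dv \<alpha> u v) (\<nu> u v)
      = \<kappa> * (cos u)^2 * sin v * cos v + (sin u)^2 * sin v * cos v - sin v * cos v * (\<psi> u)^2"
    using b_pos c_pos first
    by (simp add: mink_Q dv_eq ell_param_eq power2_eq_square)
  also have "\<dots> = 0"
    unfolding psi_squared by (simp add: algebra_simps)
  finally show ?thesis .
qed

text \<open>The second fundamental form with respect to \<open>\<nu>\<close> is \<open>- \<langle>_, Q _\<rangle>\<close>.\<close>

lemma second_partials_normal:
  "mink (du (du \<alpha>) u v) (\<nu> u v) = - mink (du \<alpha> u v) (Q (du \<alpha> u v))"
  "mink (dv (du \<alpha>) u v) (\<nu> u v) = - mink (du \<alpha> u v) (Q (dv \<alpha> u v))"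
  "mink (dv (dv \<alpha>) u v) (\<nu> u v) = - mink (dv \<alpha> u v) (Q (dv \<alpha> u v))"
proof -
  have U: "((\<lambda>s. \<alpha> s v) has_vector_derivative du \<alpha> u v) (at u)"
    using ell_param_du by (simp add: du_eq)
  have V: "((\<lambda>t. \<alpha> u t) has_vector_derivative dv \<alpha> u v) (at v)"
    using ell_param_dv by (simp add: dv_eq)
  show "mink (du (du \<alpha>) u v) (\<nu> u v) = - mink (du \<alpha> u v) (Q (du \<alpha> u v))"
    unfolding du_def[of "du \<alpha>"]
    by (rule conormal_derivative[OF second_partials_exist(1) U du_tangent])
  show "mink (dv (du \<alpha>) u v) (\<nu> u v) = - mink (du \<alpha> u v) (Q (dv \<alpha> u v))"
    unfolding dv_def[of "du \<alpha>"]
    by (rule conormal_derivative[OF second_partials_exist(2) V du_tangent])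
  show "mink (dv (dv \<alpha>) u v) (\<nu> u v) = - mink (dv \<alpha> u v) (Q (dv \<alpha> u v))"
    unfolding dv_def[of "dv \<alpha>"]
    by (rule conormal_derivative[OF second_partials_exist(3) V dv_tangent])
qed

text \<open>On tangent vectors the normal right-hand side of \<open>focal_derivative_u\<close> drops out, leaving a
  proportionality between the two fundamental forms along the \<open>u\<close>-direction.\<close>

lemma mink_du_eq:
  assumes "mink w (\<nu> u v) = 0" shows "mink (du \<alpha> u v) w = - \<mu>\<^sub>1 u * mink (du \<alpha> u v) (Q w)"
  using arg_cong[OF focal_derivative_u, of "\<lambda>p. mink p w" u v] assms
  by (simp add: mink_add_left mink_scaleR_left mink_commute[of "\<nu> u v" w]
      mink_commute[of "Q (du \<alpha> u v)" w] mink_Q_symmetric[of w "du \<alpha> u v"]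
      del: scaleR_minus_left)

lemma mink_dv_eq:
  assumes "mink w (\<nu> u v) = 0" shows "mink (dv \<alpha> u v) w = - \<mu>\<^sub>2 v * mink (dv \<alpha> u v) (Q w)"
  using arg_cong[OF focal_derivative_v, of "\<lambda>p. mink p w" u v] assms
  by (simp add: mink_add_left mink_scaleR_left mink_commute[of "\<nu> u v" w]
      mink_commute[of "Q (dv \<alpha> u v)" w] mink_Q_symmetric[of w "dv \<alpha> u v"])

lemma coeff_E_eq: "coeff_E \<alpha> u v = - \<mu>\<^sub>1 u * mink (du \<alpha> u v) (Q (du \<alpha> u v))"
  unfolding coeff_E_def by (rule mink_du_eq[OF du_tangent])

lemma coeff_G_eq: "coeff_G \<alpha> u v = - \<mu>\<^sub>2 v * mink (dv \<alpha> u v) (Q (dv \<alpha> u v))"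
  unfolding coeff_G_def by (rule mink_dv_eq[OF dv_tangent])

text \<open>\<open>F\<close> is proportional to the mixed term \<open>\<langle>\<alpha>\<^sub>u, Q \<alpha>\<^sub>v\<rangle>\<close> in two ways, through \<open>\<mu>\<^sub>1\<close> and through \<open>\<mu>\<^sub>2\<close>.
  As the two factors differ, both quantities vanish, just as eigenvectors for distinct
  eigenvalues are orthogonal.\<close>

lemma coordinate_curves_conjugate:
  assumes "sin u \<noteq> 0 \<or> sin v \<noteq> 0"
  shows "mink (du \<alpha> u v) (Q (dv \<alpha> u v)) = 0" "coeff_F \<alpha> u v = 0"
proof -
  let ?T = "mink (du \<alpha> u v) (Q (dv \<alpha> u v))"
  have 1: "coeff_F \<alpha> u v = - \<mu>\<^sub>1 u * ?T"
    unfolding coeff_F_def by (rule mink_du_eq[OF dv_tangent])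
  have 2: "coeff_F \<alpha> u v = - \<mu>\<^sub>2 v * ?T"
    unfolding coeff_F_def mink_commute[of "du \<alpha> u v" "dv \<alpha> u v"]
      mink_Q_symmetric[of "du \<alpha> u v" "dv \<alpha> u v"]
    by (rule mink_dv_eq[OF du_tangent])
  have "- \<mu>\<^sub>1 u * ?T = - \<mu>\<^sub>2 v * ?T"
    unfolding 1[symmetric] by (rule 2)
  then show "?T = 0"
    using mu_distinct[OF assms] by auto
  with 1 show "coeff_F \<alpha> u v = 0" by simp
qed

text \<open>\<open>EG\<close> is \<open>\<mu>\<^sub>1 \<mu>\<^sub>2\<close> times two values of the positive definite form, and \<open>\<mu>\<^sub>1 < 0\<close>. So the form
  degenerates where a partial derivative vanishes, which is where \<open>sin u = sin v = 0\<close>, and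
  on the curves \<open>\<mu>\<^sub>2 = 0\<close>, where the tangent plane of the ellipsoid is lightlike.\<close>

lemma disc_nonzero_iff: "disc \<alpha> u v \<noteq> 0 \<longleftrightarrow> (sin u \<noteq> 0 \<or> sin v \<noteq> 0) \<and> \<mu>\<^sub>2 v \<noteq> 0"
proof (cases "sin u \<noteq> 0 \<or> sin v \<noteq> 0")
  case True
  have U: "du \<alpha> u v \<noteq> 0"
  proof
    assume "du \<alpha> u v = 0"
    then have "sin u = 0" "cos u * sin v = 0"
      using a_pos b_pos phi_pos[of v] by (simp_all add: du_eq vec_eq_iff forall_3)
    then show False
      using True sin_zero_abs_cos_one[of u] by auto
  qed
  have V: "dv \<alpha> u v \<noteq> 0"
  proof
    assume "dv \<alpha> u v = 0"
    then have "sin v = 0" "sin u * cos v = 0"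
      using b_pos c_pos psi_pos[of u] by (simp_all add: dv_eq vec_eq_iff forall_3)
    then show False
      using True sin_zero_abs_cos_one[of v] by auto
  qed
  have "disc \<alpha> u v = \<mu>\<^sub>1 u * mink (du \<alpha> u v) (Q (du \<alpha> u v)) * (\<mu>\<^sub>2 v * mink (dv \<alpha> u v) (Q (dv \<alpha> u v)))"
    by (simp add: disc_def coordinate_curves_conjugate(2)[OF True] coeff_E_eq coeff_G_eq)
  then show ?thesis
    using True mink_Q_pos[OF U] mink_Q_pos[OF V] mu1_neg[of u] by auto
next
  case False
  then have "du \<alpha> u v = 0"
    by (simp add: du_eq vec_eq_iff forall_3)
  then have "disc \<alpha> u v = 0"
    by (simp add: disc_def coeff_E_def coeff_F_def mink_def)
  then show ?thesis using False by simp
qed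

section \<open>The focal sheets\<close>

lemma unit_normal_parallel:
  assumes "disc \<alpha> u v \<noteq> 0"
  obtains h where "h \<noteq> 0" "unit_normal \<alpha> u v = h *\<^sub>R \<nu> u v"
proof -
  have "\<nu> u v \<noteq> 0"
    using mink_Q_ell_param[of u v] by (auto simp: mink_def)
  then obtain l where l: "mcross (du \<alpha> u v) (dv \<alpha> u v) = l *\<^sub>R \<nu> u v"
    using mcross_parallel_normal[OF du_tangent dv_tangent] by blast
  obtain r where "unit_normal \<alpha> u v = r *\<^sub>R mcross (du \<alpha> u v) (dv \<alpha> u v)"
    unfolding unit_normal_def Let_def by blast
  then have N: "unit_normal \<alpha> u v = (r * l) *\<^sub>R \<nu> u v"
    by (simp add: l)
  have "mink (mcross (du \<alpha> u v) (dv \<alpha> u v)) (unit_normal \<alpha> u v) \<noteq> 0"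
    using unit_normal_oriented[OF assms] by (simp add: mink_mcross)
  then have "r * l \<noteq> 0"
    by (auto simp: N mink_scaleR_right)
  then show ?thesis using N that by blast
qed

text \<open>On a line \<open>u = const\<close> the degenerate points satisfy \<open>sin t = 0\<close> or \<open>sin\<^sup>2 t = b\<^sup>2/(b\<^sup>2 + c\<^sup>2)\<close>, so
  there are only countably many.\<close>

lemma regular_points_dense: "(u, v) islimpt {(s, t). disc \<alpha> s t \<noteq> 0}"
proof (rule islimpt_countable_fibre)
  define r where "r = b / sqrt (b^2 + c^2)"
  have "sin t = 0 \<or> sin t = r \<or> sin t = - r" if "\<not> (sin t \<noteq> 0 \<and> \<mu>\<^sub>2 t \<noteq> 0)" for t
  proof -
    have "(sin t)^2 = r^2" if "\<mu>\<^sub>2 t = 0"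
      using that sq_sums_pos b_pos
      by (simp add: \<mu>\<^sub>2_def r_def power_divide eq_divide_eq mult.commute)
    then show ?thesis
      using that by (auto simp: power2_eq_iff)
  qed
  then have "{t. (u, t) \<notin> {(s, t). disc \<alpha> s t \<noteq> 0}}
      \<subseteq> {t. sin t = 0} \<union> {t. sin t = r} \<union> {t. sin t = - r}"
    by (auto simp: disc_nonzero_iff)
  then show "countable {t. (u, t) \<notin> {(s, t). disc \<alpha> s t \<noteq> 0}}"
    by (rule countable_subset) (intro countable_Un countable_sin_level)
qed

lemma tendsto_conormal: "((\<lambda>(s, t). \<nu> s t) \<longlongrightarrow> \<nu> u v) (at (u, v))"
proof -
  have u: "(fst \<longlongrightarrow> u) (at (u, v))" and v: "(snd \<longlongrightarrow> v) (at (u, v))"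
    using tendsto_fst[OF tendsto_ident_at, of "(u, v)"] tendsto_snd[OF tendsto_ident_at, of "(u, v)"]
    by simp_all
  have U: "((\<lambda>x. \<psi> (fst x)) \<longlongrightarrow> \<psi> u) (at (u, v))"
    and V: "((\<lambda>x. \<phi> (snd x)) \<longlongrightarrow> \<phi> v) (at (u, v))"
    unfolding \<psi>_def \<phi>_def
    by (rule isCont_tendsto_compose[OF continuous_ell_radical u]
        isCont_tendsto_compose[OF continuous_ell_radical v])+
  show ?thesis
    unfolding case_prod_beta Q_def ell_param_eq vector_3
    by (intro tendsto_vector_3 tendsto_intros U V u v) (use a_pos b_pos c_pos in simp_all)
qed

text \<open>With \<open>N = h \<nu>\<close> one finds \<open>e/E = h/\<mu>\<^sub>1\<close> and \<open>g/G = h/\<mu>\<^sub>2\<close>, so \<open>h\<close> cancels.\<close>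

lemma principal_curvature_inverse:
  assumes R: "disc \<alpha> u v \<noteq> 0"
  shows "coeff_e \<alpha> u v / coeff_E \<alpha> u v \<noteq> 0 \<and>
      (1 / (coeff_e \<alpha> u v / coeff_E \<alpha> u v)) *\<^sub>R unit_normal \<alpha> u v = \<mu>\<^sub>1 u *\<^sub>R \<nu> u v"
    "coeff_g \<alpha> u v / coeff_G \<alpha> u v \<noteq> 0 \<and>
      (1 / (coeff_g \<alpha> u v / coeff_G \<alpha> u v)) *\<^sub>R unit_normal \<alpha> u v = \<mu>\<^sub>2 v *\<^sub>R \<nu> u v"
proof -
  obtain h where h: "h \<noteq> 0" "unit_normal \<alpha> u v = h *\<^sub>R \<nu> u v"
    using unit_normal_parallel[OF R] .
  have reg: "sin u \<noteq> 0 \<or> sin v \<noteq> 0" "\<mu>\<^sub>2 v \<noteq> 0"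
    using R by (auto simp: disc_nonzero_iff)
  have "coeff_F \<alpha> u v = 0"
    using coordinate_curves_conjugate(2)[OF reg(1)] .
  then have EG: "coeff_E \<alpha> u v \<noteq> 0" "coeff_G \<alpha> u v \<noteq> 0"
    using R by (auto simp: disc_def)
  have e: "coeff_e \<alpha> u v = - (h * mink (du \<alpha> u v) (Q (du \<alpha> u v)))"
    and g: "coeff_g \<alpha> u v = - (h * mink (dv \<alpha> u v) (Q (dv \<alpha> u v)))"
    by (simp_all add: coeff_e_def coeff_g_def h mink_scaleR_right second_partials_normal)
  have "coeff_e \<alpha> u v / coeff_E \<alpha> u v = h / \<mu>\<^sub>1 u"
    using EG(1) by (simp add: e coeff_E_eq)
  then show "coeff_e \<alpha> u v / coeff_E \<alpha> u v \<noteq> 0 \<and>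
      (1 / (coeff_e \<alpha> u v / coeff_E \<alpha> u v)) *\<^sub>R unit_normal \<alpha> u v = \<mu>\<^sub>1 u *\<^sub>R \<nu> u v"
    using h mu1_neg[of u] by simp
  have "coeff_g \<alpha> u v / coeff_G \<alpha> u v = h / \<mu>\<^sub>2 v"
    using EG(2) by (simp add: g coeff_G_eq)
  then show "coeff_g \<alpha> u v / coeff_G \<alpha> u v \<noteq> 0 \<and>
      (1 / (coeff_g \<alpha> u v / coeff_G \<alpha> u v)) *\<^sub>R unit_normal \<alpha> u v = \<mu>\<^sub>2 v *\<^sub>R \<nu> u v"
    using h reg(2) by simp
qed

lemma principal_curvatures_coordinate_directions:
  "principal_curvatures_uv \<alpha> (\<lambda>u v. coeff_e \<alpha> u v / coeff_E \<alpha> u v)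
     (\<lambda>u v. coeff_g \<alpha> u v / coeff_G \<alpha> u v)"
proof (rule principal_curvatures_uv_of_orthogonal)
  fix u v assume R: "disc \<alpha> u v \<noteq> 0"
  then have reg: "sin u \<noteq> 0 \<or> sin v \<noteq> 0"
    by (simp add: disc_nonzero_iff)
  show "coeff_F \<alpha> u v = 0"
    by (rule coordinate_curves_conjugate(2)[OF reg])
  obtain h where "unit_normal \<alpha> u v = h *\<^sub>R \<nu> u v"
    using unit_normal_parallel[OF R] .
  then show "coeff_f \<alpha> u v = 0"
    by (simp add: coeff_f_def mink_scaleR_right second_partials_normal
        coordinate_curves_conjugate(1)[OF reg])
qed

lemma focal_sheet_u:
  "focal_point \<alpha> (\<lambda>u v. coeff_e \<alpha> u v / coeff_E \<alpha> u v) u v (\<alpha> u v + \<mu>\<^sub>1 u *\<^sub>R \<nu> u v)"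
proof (rule focal_point_of_continuous_extension[OF _ _ regular_points_dense])
  have "((\<lambda>x. \<mu>\<^sub>1 (fst x)) \<longlongrightarrow> \<mu>\<^sub>1 (fst (u, v))) (at (u, v))"
    unfolding \<mu>\<^sub>1_def by (intro tendsto_intros)
  from tendsto_scaleR[OF this tendsto_conormal]
  show "((\<lambda>(s, t). \<mu>\<^sub>1 s *\<^sub>R \<nu> s t) \<longlongrightarrow> \<mu>\<^sub>1 u *\<^sub>R \<nu> u v) (at (u, v))"
    by (simp add: case_prod_unfold)
qed (rule principal_curvature_inverse(1))

lemma focal_sheet_v:
  "focal_point \<alpha> (\<lambda>u v. coeff_g \<alpha> u v / coeff_G \<alpha> u v) u v (\<alpha> u v + \<mu>\<^sub>2 v *\<^sub>R \<nu> u v)"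
proof (rule focal_point_of_continuous_extension[OF _ _ regular_points_dense])
  have "((\<lambda>x. \<mu>\<^sub>2 (snd x)) \<longlongrightarrow> \<mu>\<^sub>2 (snd (u, v))) (at (u, v))"
    unfolding \<mu>\<^sub>2_def by (intro tendsto_intros)
  from tendsto_scaleR[OF this tendsto_conormal]
  show "((\<lambda>(s, t). \<mu>\<^sub>2 t *\<^sub>R \<nu> s t) \<longlongrightarrow> \<mu>\<^sub>2 v *\<^sub>R \<nu> u v) (at (u, v))"
    by (simp add: case_prod_unfold)
qed (rule principal_curvature_inverse(2))

lemma sqrt_psi_radicand:
  "sqrt ((b^2 + c^2) * (cos u)^2 + (a^2 + c^2) * (sin u)^2) = sqrt (a^2 + c^2) * \<psi> u"
  and sqrt_phi_radicand:
  "sqrt ((a^2 - b^2) * (cos v)^2 + (a^2 + c^2) * (sin v)^2) = sqrt (a^2 + c^2) * \<phi> v"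
  using psi_pos[of u] phi_pos[of v]
  by (simp_all only: psi_squared_scaled[symmetric] phi_squared_scaled[symmetric] real_sqrt_mult
      real_sqrt_abs abs_of_pos)

lemma powr_psi_radicand: "((b^2 + c^2) * (cos u)^2 + (a^2 + c^2) * (sin u)^2) powr (3/2)
    = (a^2 + c^2) * (\<psi> u)^2 * (sqrt (a^2 + c^2) * \<psi> u)"
  and powr_phi_radicand: "((a^2 - b^2) * (cos v)^2 + (a^2 + c^2) * (sin v)^2) powr (3/2)
    = (a^2 + c^2) * (\<phi> v)^2 * (sqrt (a^2 + c^2) * \<phi> v)"
  using sq_sums_pos psi_pos[of u] phi_pos[of v]
  by (simp_all only: sqrt_psi_radicand[symmetric] sqrt_phi_radicand[symmetric] psi_squared_scaled[symmetric]
      phi_squared_scaled[symmetric] powr_three_halves zero_le_mult_iff zero_le_power2 less_imp_le simp_thms)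

lemma focal_formula_u:
  "\<alpha> u v + \<mu>\<^sub>1 u *\<^sub>R \<nu> u v = vector
    [(a^2 - b^2) * (cos u)^3 / (a * sqrt (a^2 + c^2))
       * sqrt ((a^2 - b^2) * (cos v)^2 + (a^2 + c^2) * (sin v)^2),
     - ((a^2 - b^2) * (sin u)^3 * sin v / b),
     cos v / (c * sqrt (a^2 + c^2))
       * ((b^2 + c^2) * (cos u)^2 + (a^2 + c^2) * (sin u)^2) powr (3/2)]"
proof -
  have "sqrt (a^2 + c^2) \<noteq> 0"
    using a_pos by simp
  then show ?thesis
    unfolding add_scaled_Q mu1_shifts sqrt_phi_radicand powr_psi_radicand using a_pos b_pos c_pos
    by (simp add: ell_param_eq vec_eq_iff forall_3 power2_eq_square power3_eq_cube)
qed

lemma focal_formula_v: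
  "\<alpha> u v + \<mu>\<^sub>2 v *\<^sub>R \<nu> u v = vector
    [cos u / (a * sqrt (a^2 + c^2))
       * ((a^2 - b^2) * (cos v)^2 + (a^2 + c^2) * (sin v)^2) powr (3/2),
     (b^2 + c^2) * sin u * (sin v)^3 / b,
     (b^2 + c^2) * (cos v)^3 / (c * sqrt (a^2 + c^2))
       * sqrt ((b^2 + c^2) * (cos u)^2 + (a^2 + c^2) * (sin u)^2)]"
proof -
  have "sqrt (a^2 + c^2) \<noteq> 0"
    using a_pos by simp
  then show ?thesis
    unfolding add_scaled_Q mu2_shifts sqrt_psi_radicand powr_phi_radicand using a_pos b_pos c_pos
    by (simp add: ell_param_eq vec_eq_iff forall_3 power2_eq_square power3_eq_cube)
qed

end

theorem proposition7p1:
  fixes a b c :: real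
  assumes "a > b" and "b > 0" and "c > 0"
  shows "range (\<lambda>(u, v). ell_param a b c u v) = ellipsoid a b c \<and>
    (\<exists>k1 k2.
      (principal_curvatures_uv (ell_param a b c) k1 k2 \<or>
       principal_curvatures_uv (ell_param a b c) k2 k1) \<and>
      (\<forall>u v. focal_point (ell_param a b c) k1 u v (vector
        [(a^2 - b^2) * (cos u)^3 / (a * sqrt (a^2 + c^2))
           * sqrt ((a^2 - b^2) * (cos v)^2 + (a^2 + c^2) * (sin v)^2),
         - ((a^2 - b^2) * (sin u)^3 * sin v / b),
         cos v / (c * sqrt (a^2 + c^2))
           * ((b^2 + c^2) * (cos u)^2 + (a^2 + c^2) * (sin u)^2) powr (3/2)])) \<and>
      (\<forall>u v. focal_point (ell_param a b c) k2 u v (vector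
        [cos u / (a * sqrt (a^2 + c^2))
           * ((a^2 - b^2) * (cos v)^2 + (a^2 + c^2) * (sin v)^2) powr (3/2),
         (b^2 + c^2) * sin u * (sin v)^3 / b,
         (b^2 + c^2) * (cos v)^3 / (c * sqrt (a^2 + c^2))
           * sqrt ((b^2 + c^2) * (cos u)^2 + (a^2 + c^2) * (sin u)^2)])))"
proof -
  interpret ellipsoid_axes a b c
    using assms by unfold_locales
  show ?thesis
  proof (intro conjI exI allI)
    show "range (\<lambda>(u, v). ell_param a b c u v) = ellipsoid a b c"
      by (rule range_ell_param)
    show "principal_curvatures_uv \<alpha> (\<lambda>u v. coeff_e \<alpha> u v / coeff_E \<alpha> u v)
        (\<lambda>u v. coeff_g \<alpha> u v / coeff_G \<alpha> u v) \<or>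
      principal_curvatures_uv \<alpha> (\<lambda>u v. coeff_g \<alpha> u v / coeff_G \<alpha> u v)
        (\<lambda>u v. coeff_e \<alpha> u v / coeff_E \<alpha> u v)"
      by (rule disjI1[OF principal_curvatures_coordinate_directions])
  qed (rule focal_sheet_u[unfolded focal_formula_u] focal_sheet_v[unfolded focal_formula_v])+
qed

end
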